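(* Let $A\in\mathbb{R}^{m\times n}$, $b\in\mathbb{R}^m$ with $Ax=b$ consistent, and let $(\Omega,\mathcal{F},\mathbf{P})$ be a probability space of matrices $S\in\mathbb{R}^{m\times q}$ such that $\mathbb{E}[SS^\top]$ is positive definite. Let $H=\mathbb{E}\big[\frac{SS^\top}{\|S^\top A\|_2^2}\big]$ (with the convention $\frac00=0$), and let $\{x^k\}_{k\ge0}$ be generated by the RIM-AS algorithm described in the context. Then for each $k$, $$\mathbb{E}_{S_k\in\Omega}\big[\|x^{k+1}-A^\dagger b\|_2^2\mid x^k\big]\le\big(1-q_k\,\sigma_{\min}^2(H^{1/2}A)\big)\,\|x^k-A^\dagger b\|_2^2,$$ where $q_k$ is defined in the context.
   Context: $A^\dagger$ is the Moore–Penrose pseudoinverse; $\sigma_{\min}(B)$ is the smallest nonzero singular value of $B$; $V^\dagger$ is the pseudoinverse of $V$. RIM-AS algorithm: fix a positive integer $\ell$ and $x^0\in\operatorname{Range}(A^\top)$. For $k=0,1,2,\dots$: (1) randomly draw $S_k\in\Omega$ according to $\mathbf{P}$ (redrawing until $S_k^\top(Ax^k-b)\neq0$); (2) set $j_k=\max\{k-\ell+1,0\}$ and $M_k=(x^{j_k}-x^k,\dots,x^{k-1}-x^k,-A^\top S_kS_k^\top(Ax^k-b))\in\mathbb{R}^{n\times(k-j_k+1)}$; (3) set $\gamma_k=\|S_k^\top(Ax^k-b)\|_2^2$ and let $s_k$ solve $M_k^\top M_ks_k=\gamma_k e$, where $e$ is the last standard unit vector of $\mathbb{R}^{k-j_k+1}$;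 (4) set $x^{k+1}=x^k+M_ks_k$. (Equivalently, $x^{k+1}$ is the orthogonal projection of $A^\dagger b$ onto $x^k+\operatorname{Range}(M_k)$.) Define $V_0=\emptyset$ (so $V_0V_0^\dagger=0$) and $V_k=(x^{j_k}-x^k,\dots,x^{k-1}-x^k)$ for $k\ge1$, $d_k=-A^\top S_kS_k^\top(Ax^k-b)$, $\mathcal{Q}_k=\{S\in\Omega: S^\top(Ax^k-b)\neq0\}$, and $$q_k=\inf_{S_k\in\mathcal{Q}_k}\Big(1-\frac{\|V_kV_k^\dagger d_k\|_2^2}{\|d_k\|_2^2}\Big)^{-1}\ (\ge1).$$ The expectation is over the random choice of $S_k$ given $x^k$. *)

theory Defs
  imports "HOL-Probability.Probability"
begin

text \<open>Moore--Penrose pseudoinverse of a (type-dimensioned) real matrix, via the Penrose conditions.\<close>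
definition pinv :: "real^'n^'m \<Rightarrow> real^'m^'n" where
  "pinv A = (THE X. A ** X ** A = A \<and> X ** A ** X = X \<and>
                   transpose (A ** X) = A ** X \<and> transpose (X ** A) = X ** A)"

text \<open>Orthogonal projection onto span U (this is V V^dagger when U is the set of columns of V).\<close>
definition proj_span :: "('a::euclidean_space) set \<Rightarrow> 'a \<Rightarrow> 'a" where
  "proj_span U d = (THE p. p \<in> span U \<and> (\<forall>u\<in>U. (d - p) \<bullet> u = 0))"

definition pos_def_mat :: "real^'n^'n \<Rightarrow> bool" where
  "pos_def_mat B \<longleftrightarrow> (\<forall>v. v \<noteq> 0 \<longrightarrow> v \<bullet> (B *v v) > 0)"

text \<open>Principal (symmetric positive semidefinite) square root.\<close>
definition msqrt :: "real^'n^'n \<Rightarrow> real^'n^'n" where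
  "msqrt H = (THE R. transpose R = R \<and> (\<forall>v. 0 \<le> v \<bullet> (R *v v)) \<and> R ** R = H)"

text \<open>Smallest nonzero singular value: singular values are the square roots of the eigenvalues of B^T B.\<close>
definition sigma_min :: "real^'n^'m \<Rightarrow> real" where
  "sigma_min B = Inf {\<sigma>. \<sigma> > 0 \<and> (\<exists>v. v \<noteq> 0 \<and> (transpose B ** B) *v v = scaleR (\<sigma>^2) v)}"

text \<open>Spectral norm of a matrix.\<close>
definition spec_norm :: "real^'n^'m \<Rightarrow> real" where
  "spec_norm B = onorm (\<lambda>x. B *v x)"

text \<open>H = E[ S S^T / ||S^T A||_2^2 ] (division by zero gives zero in HOL, matching 0/0 = 0).\<close>
definition Hmat :: "(real^'q^'m) measure \<Rightarrow> real^'n^'m \<Rightarrow> real^'m^'m" where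
  "Hmat M A = integral\<^sup>L M (\<lambda>S. scaleR (1 / (spec_norm (transpose S ** A))^2) (S ** transpose S))"

text \<open>RIM-AS ingredients, given the history xs = [x^0, ..., x^k] and the drawn S.\<close>
definition rim_V :: "nat \<Rightarrow> (real^'n) list \<Rightarrow> (real^'n) list" where
  "rim_V l xs = (let k = length xs - 1; j = Suc k - l in map (\<lambda>i. xs ! i - xs ! k) [j..<k])"

definition rim_d :: "real^'n^'m \<Rightarrow> real^'m \<Rightarrow> (real^'n) list \<Rightarrow> real^'q^'m \<Rightarrow> real^'n" where
  "rim_d A b xs S = - (transpose A *v (S *v (transpose S *v (A *v last xs - b))))"

definition rim_step :: "real^'n^'m \<Rightarrow> real^'m \<Rightarrow> nat \<Rightarrow> (real^'n) list \<Rightarrow> real^'q^'m \<Rightarrow> real^'n" where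
  "rim_step A b l xs S =
     (let cols = rim_V l xs @ [rim_d A b xs S];
          L = length cols;
          \<gamma> = (norm (transpose S *v (A *v last xs - b)))^2;
          s = (SOME s :: nat \<Rightarrow> real. \<forall>i<L.
                 cols ! i \<bullet> (\<Sum>j<L. scaleR (s j) (cols ! j)) = (if i = L - 1 then \<gamma> else 0))
      in last xs + (\<Sum>j<L. scaleR (s j) (cols ! j)))"

text \<open>History [x^0, ..., x^k] produced from x^0 and the draws Ss 0, ..., Ss (k-1).\<close>
fun rim_hist :: "real^'n^'m \<Rightarrow> real^'m \<Rightarrow> nat \<Rightarrow> real^'n \<Rightarrow> (nat \<Rightarrow> real^'q^'m) \<Rightarrow> nat \<Rightarrow> (real^'n) list" where
  "rim_hist A b l x0 Ss 0 = [x0]"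
| "rim_hist A b l x0 Ss (Suc k) =
     (let xs = rim_hist A b l x0 Ss k in xs @ [rim_step A b l xs (Ss k)])"

definition rim_Q :: "(real^'q^'m) measure \<Rightarrow> real^'n^'m \<Rightarrow> real^'m \<Rightarrow> real^'n \<Rightarrow> (real^'q^'m) set" where
  "rim_Q M A b x = {S \<in> space M. transpose S *v (A *v x - b) \<noteq> 0}"

definition rim_q :: "(real^'q^'m) measure \<Rightarrow> real^'n^'m \<Rightarrow> real^'m \<Rightarrow> nat \<Rightarrow> (real^'n) list \<Rightarrow> real" where
  "rim_q M A b l xs = Inf ((\<lambda>S. inverse (1 - (norm (proj_span (set (rim_V l xs)) (rim_d A b xs S)))^2
                                            / (norm (rim_d A b xs S))^2)) ` rim_Q M A b (last xs))"

end

theory Submission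
  imports Defs
begin

text \<open>
  Let x* = A^+ b and e_k = x^k - x*. Each iterate is the orthogonal projection of x* onto
  x^k + span (V_k, d_k), so by induction every e_k lies in Range A^T and is orthogonal to the
  stored directions V_k. The projection therefore removes at least the component of e_k along
  d_k' = d_k - V_k V_k^+ d_k, and |e_k . d_k'| = gamma_k = |S_k^T (A x^k - b)|^2, whence
  |e_(k+1)|^2 <= |e_k|^2 - gamma_k^2 / |d_k'|^2 = |e_k|^2 - rho(S_k) gamma_k^2 / |d_k|^2, where
  rho(S_k) = |d_k|^2 / |d_k'|^2 is the ratio whose infimum is q_k.
  As |d_k|^2 <= |S_k^T A|^2 gamma_k, the decrease is at least q_k gamma_k / |S_k^T A|^2, whose
  expectation is q_k (A e_k)^T H (A e_k) >= q_k sigma_min^2 (H^(1/2) A) |e_k|^2: the error e_k is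
  orthogonal to the kernel of A, and H is definite on Range A because E[S S^T] is.
  Conditioning on S_k^T (A x^k - b) <> 0 divides the expected decrease by a probability
  at most 1, which only helps.

  Existence of the pseudoinverse and of H^(1/2) comes from the spectral theorem for symmetric
  matrices, obtained by maximising the Rayleigh quotient.
\<close>

section \<open>Symmetric matrices and the spectral theorem\<close>

lemma inner_transpose_left: "(transpose A *v x) \<bullet> y = x \<bullet> ((A::real^'n^'m) *v y)"
  by (simp add: transpose_matrix_vector dot_lmul_matrix)

lemma inner_transpose_right: "y \<bullet> (transpose A *v x) = ((A::real^'n^'m) *v y) \<bullet> x"
  by (metis inner_transpose_left inner_commute)

lemma symmetric_matrixI:
  fixes G :: "real^'n^'n"
  assumes "\<And>x y. (G *v x) \<bullet> y = x \<bullet> (G *v y)"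
  shows "transpose G = G"
proof -
  have "transpose G *v x = G *v x" for x
    using vector_eq_rdot by (metis assms inner_transpose_left)
  then show ?thesis by (simp add: matrix_eq)
qed

lemma inner_symmetric_matrix: "transpose G = G \<Longrightarrow> (G *v x) \<bullet> y = x \<bullet> ((G::real^'n^'n) *v y)"
  by (metis inner_transpose_left)

lemma norm_transpose_le_onorm:
  fixes B :: "real^'n^'m"
  shows "norm (transpose B *v w) \<le> onorm (\<lambda>x. B *v x) * norm w"
proof -
  have bl: "bounded_linear (\<lambda>x. B *v x)" by (simp add: matrix_vector_mul_bounded_linear)
  define u where "u = transpose B *v w"
  have "(norm u)^2 = w \<bullet> (B *v u)"
    unfolding power2_norm_eq_inner u_def by (rule inner_transpose_left)
  also have "\<dots> \<le> norm w * norm (B *v u)" by (rule norm_cauchy_schwarz)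
  also have "\<dots> \<le> (onorm (\<lambda>x. B *v x) * norm w) * norm u"
    using onorm[OF bl, of u] by (simp add: mult_left_mono mult.commute mult.left_commute)
  finally have "norm u * norm u \<le> (onorm (\<lambda>x. B *v x) * norm w) * norm u"
    by (simp add: power2_eq_square)
  then show ?thesis
    using onorm_pos_le[OF bl] unfolding u_def[symmetric]
    by (cases "u = 0") (simp_all add: mult_le_cancel_right)
qed

lemma linear_coeff_zero_if_quadratic_nonpos:
  fixes a c :: real
  assumes "\<And>t. t * a + t^2 * c \<le> 0"
  shows "a = 0"
proof -
  define k where "k = \<bar>c\<bar> + 1"
  have k: "k > 0" "k + c \<ge> 1" by (auto simp: k_def)
  have "a^2 * (k + c) = k^2 * ((a / k) * a + (a / k)^2 * c)"
    using k by (simp add: field_simps power2_eq_square)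
  also have "\<dots> \<le> 0"
    using assms[of "a / k"] by (intro mult_nonneg_nonpos) simp_all
  finally have "a^2 * (k + c) \<le> 0" .
  with k show "a = 0" by (smt (verit) mult_le_0_iff power2_less_eq_zero_iff)
qed

definition orthonormal :: "'a::real_inner set \<Rightarrow> bool" where
  "orthonormal B \<longleftrightarrow> finite B \<and> pairwise orthogonal B \<and> (\<forall>b\<in>B. norm b = 1)"

lemma orthonormal_inner:
  "orthonormal B \<Longrightarrow> b \<in> B \<Longrightarrow> c \<in> B \<Longrightarrow> b \<bullet> c = (if b = c then 1 else 0)"
  by (auto simp: orthonormal_def pairwise_def orthogonal_def dot_square_norm)

lemma orthonormal_expand: "orthonormal B \<Longrightarrow> x \<in> span B \<Longrightarrow> (\<Sum>b\<in>B. (x \<bullet> b) *\<^sub>R b) = x"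
  by (intro orthonormal_basis_expand) (auto simp: orthonormal_def)

lemma orthonormal_parseval:
  assumes "orthonormal B" "x \<in> span B"
  shows "x \<bullet> y = (\<Sum>b\<in>B. (x \<bullet> b) * (y \<bullet> b))"
proof -
  have "x \<bullet> y = (\<Sum>b\<in>B. (x \<bullet> b) *\<^sub>R b) \<bullet> y" using orthonormal_expand[OF assms] by simp
  also have "\<dots> = (\<Sum>b\<in>B. (x \<bullet> b) * (b \<bullet> y))" by (simp add: inner_sum_left)
  finally show ?thesis by (simp add: inner_commute)
qed

definition orthonormal_eigenbasis :: "real^'n^'n \<Rightarrow> (real^'n) set \<Rightarrow> (real^'n) set \<Rightarrow> bool" where
  "orthonormal_eigenbasis G W B \<longleftrightarrow>
     orthonormal B \<and> span B = W \<and> (\<forall>b\<in>B. G *v b = (b \<bullet> (G *v b)) *\<^sub>R b)"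

lemma invariant_subspace_unit_eigenvector:
  fixes G :: "real^'n^'n"
  assumes sym: "transpose G = G" and W: "subspace W" and inv: "\<And>x. x \<in> W \<Longrightarrow> G *v x \<in> W"
    and ne: "W \<noteq> {0}"
  obtains e where "e \<in> W" "norm e = 1" "G *v e = (e \<bullet> (G *v e)) *\<^sub>R e"
proof -
  \<comment> \<open>A maximiser of the Rayleigh quotient on the unit sphere of W is an eigenvector.\<close>
  define K where "K = W \<inter> sphere 0 1"
  obtain x0 where x0: "x0 \<in> W" "x0 \<noteq> 0" using ne W subspace_0 by blast
  then have "(1 / norm x0) *\<^sub>R x0 \<in> K" using W by (simp add: K_def subspace_scale)
  moreover have "compact K"
    unfolding K_def by (rule closed_Int_compact[OF closed_subspace[OF W] compact_sphere])
  moreover have "continuous_on K (\<lambda>x. x \<bullet> (G *v x))"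
    by (intro continuous_intros matrix_vector_mult_linear_continuous_on)
  ultimately obtain e where eK: "e \<in> K" and emax: "\<And>y. y \<in> K \<Longrightarrow> y \<bullet> (G *v y) \<le> e \<bullet> (G *v e)"
    using continuous_attains_sup by (metis empty_iff)
  define \<mu> where "\<mu> = e \<bullet> (G *v e)"
  have eW: "e \<in> W" and ee: "e \<bullet> e = 1" using eK by (auto simp: K_def dot_square_norm)
  have bound: "x \<bullet> (G *v x) \<le> \<mu> * (x \<bullet> x)" if "x \<in> W" for x
  proof (cases "x = 0")
    case False
    have "(1 / norm x) *\<^sub>R x \<in> K" using that False W by (simp add: K_def subspace_scale)
    moreover have "((1 / norm x) *\<^sub>R x) \<bullet> (G *v ((1 / norm x) *\<^sub>R x)) = (x \<bullet> (G *v x)) / (norm x)^2"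
      by (simp add: matrix_vector_mult_scaleR power2_eq_square)
    ultimately have "(x \<bullet> (G *v x)) / (norm x)^2 \<le> \<mu>"
      using emax by (metis \<mu>_def)
    with False show ?thesis by (simp add: divide_le_eq power2_norm_eq_inner)
  qed simp
  define w where "w = G *v e - \<mu> *\<^sub>R e"
  have wW: "w \<in> W" unfolding w_def using inv eW W by (simp add: subspace_diff subspace_scale)
  have ew: "e \<bullet> w = 0" by (simp add: w_def \<mu>_def inner_diff_right ee)
  have eGw: "e \<bullet> (G *v w) = w \<bullet> w"
    by (simp add: inner_symmetric_matrix[OF sym, symmetric] w_def inner_diff_left ew[unfolded w_def])
  have "t * (2 * (w \<bullet> w)) + t^2 * (w \<bullet> (G *v w) - \<mu> * (w \<bullet> w)) \<le> 0" for t
  proof -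
    have "e + t *\<^sub>R w \<in> W" using eW wW W by (simp add: subspace_add subspace_scale)
    from bound[OF this] show ?thesis
      using ew eGw inner_symmetric_matrix[OF sym, of w e]
      by (simp add: matrix_vector_right_distrib matrix_vector_mult_scaleR inner_add_left
          inner_add_right ee \<mu>_def[symmetric] inner_commute power2_eq_square algebra_simps)
  qed
  then have "w \<bullet> w = 0" using linear_coeff_zero_if_quadratic_nonpos by fastforce
  then have "G *v e = \<mu> *\<^sub>R e" by (simp add: w_def)
  with that eW eK show ?thesis by (simp add: K_def \<mu>_def)
qed

lemma invariant_subspace_orthonormal_eigenbasis:
  fixes G :: "real^'n^'n"
  assumes sym: "transpose G = G"
  shows "subspace W \<Longrightarrow> (\<And>x. x \<in> W \<Longrightarrow> G *v x \<in> W) \<Longrightarrow> \<exists>B. orthonormal_eigenbasis G W B"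
proof (induction "dim W" arbitrary: W rule: less_induct)
  case less
  show ?case
  proof (cases "W = {0}")
    case True
    then show ?thesis
      by (intro exI[of _ "{}"]) (simp add: orthonormal_eigenbasis_def orthonormal_def)
  next
    case False
    obtain e where eW: "e \<in> W" and en: "norm e = 1" and eig: "G *v e = (e \<bullet> (G *v e)) *\<^sub>R e"
      using invariant_subspace_unit_eigenvector[OF sym less.prems False] .
    have ee: "e \<bullet> e = 1" using en by (simp add: dot_square_norm)
    define W' where "W' = {x \<in> W. e \<bullet> x = 0}"
    have sW': "subspace W'"
      using less.prems(1) by (auto simp: W'_def subspace_def inner_add_right)
    have iW': "G *v x \<in> W'" if "x \<in> W'" for x
    proof -
      have "e \<bullet> (G *v x) = (G *v e) \<bullet> x" by (simp add: inner_symmetric_matrix[OF sym])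
      also have "\<dots> = 0" using that eig by (metis (mono_tags) W'_def inner_scaleR_left mem_Collect_eq mult_zero_right)
      finally show ?thesis using that less.prems(2) by (simp add: W'_def)
    qed
    have "e \<notin> W'" using ee by (simp add: W'_def)
    moreover have "W' \<subseteq> W" by (auto simp: W'_def)
    ultimately have "W' \<subset> W" using eW by blast
    moreover have "span W' = W'" "span W = W" using sW' less.prems(1) by simp_all
    ultimately have "dim W' < dim W" using dim_psubset[of W' W] by (simp only:)
    then obtain B' where B': "orthonormal_eigenbasis G W' B'" using less.hyps sW' iW' by blast
    then have B'W': "B' \<subseteq> W'" by (auto simp: orthonormal_eigenbasis_def intro: span_base)
    have "span (insert e B') = W"
    proof
      show "span (insert e B') \<subseteq> W"
        by (rule span_minimal) (use B'W' eW less.prems(1) in \<open>auto simp: W'_def\<close>)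
      show "W \<subseteq> span (insert e B')"
      proof
        fix x assume "x \<in> W"
        then have "x - (e \<bullet> x) *\<^sub>R e \<in> span B'"
          using B' eW ee less.prems(1)
          by (simp add: orthonormal_eigenbasis_def W'_def subspace_diff subspace_scale inner_diff_right)
        then show "x \<in> span (insert e B')" by (auto simp: span_insert)
      qed
    qed
    moreover have "orthonormal (insert e B')"
    proof -
      have "orthogonal e y" if "y \<in> B'" for y using B'W' that by (auto simp: W'_def orthogonal_def)
      then show ?thesis
        using B' en by (simp add: orthonormal_eigenbasis_def orthonormal_def pairwise_insert orthogonal_commute)
    qed
    ultimately have "orthonormal_eigenbasis G W (insert e B')"
      using B' eig by (simp add: orthonormal_eigenbasis_def)
    then show ?thesis by blast
  qed
qed

lemma symmetric_matrix_orthonormal_eigenbasis: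
  fixes G :: "real^'n^'n"
  assumes "transpose G = G"
  obtains B where "orthonormal_eigenbasis G UNIV B"
  using invariant_subspace_orthonormal_eigenbasis[OF assms, of UNIV] by auto

lemma matrix_vector_expand:
  assumes "orthonormal B" "span B = UNIV"
  shows "(F::real^'n^'m) *v x = (\<Sum>b\<in>B. (x \<bullet> b) *\<^sub>R (F *v b))"
proof -
  have "F *v x = F *v (\<Sum>b\<in>B. (x \<bullet> b) *\<^sub>R b)" using orthonormal_expand[OF assms(1)] assms(2) by simp
  also have "\<dots> = (\<Sum>b\<in>B. (x \<bullet> b) *\<^sub>R (F *v b))"
    by (simp add: linear_sum[OF matrix_vector_mul_linear] matrix_vector_mult_scaleR o_def)
  finally show ?thesis .
qed

lemma matrix_eq_on_orthonormal_basis: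
  fixes F F' :: "real^'n^'m"
  assumes "orthonormal B" "span B = UNIV" "\<And>b. b \<in> B \<Longrightarrow> F *v b = F' *v b"
  shows "F = F'"
proof -
  have "F *v x = F' *v x" for x
  proof -
    have "F *v x = (\<Sum>b\<in>B. (x \<bullet> b) *\<^sub>R (F *v b))" by (rule matrix_vector_expand[OF assms(1,2)])
    also have "\<dots> = (\<Sum>b\<in>B. (x \<bullet> b) *\<^sub>R (F' *v b))" using assms(3) by simp
    also have "\<dots> = F' *v x" by (rule matrix_vector_expand[OF assms(1,2), symmetric])
    finally show ?thesis .
  qed
  then show ?thesis by (simp add: matrix_eq)
qed

text \<open>For an orthonormal eigenbasis B of G, diag_in B (\<lambda>b. f (b \<bullet> (G *v b))) is f(G).\<close>

definition diag_in :: "(real^'n) set \<Rightarrow> (real^'n \<Rightarrow> real) \<Rightarrow> real^'n^'n" where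
  "diag_in B c = matrix (\<lambda>x. \<Sum>b\<in>B. (c b * (x \<bullet> b)) *\<^sub>R b)"

lemma diag_in_apply: "diag_in B c *v x = (\<Sum>b\<in>B. (c b * (x \<bullet> b)) *\<^sub>R b)"
proof -
  have "linear (\<lambda>x. \<Sum>b\<in>B. (c b * (x \<bullet> b)) *\<^sub>R b)"
    by (intro linear_compose_sum) (auto simp: linear_iff inner_add_left algebra_simps)
  then show ?thesis by (simp add: diag_in_def)
qed

lemma inner_diag_in_basis:
  assumes "orthonormal B" "b' \<in> B"
  shows "(diag_in B c *v x) \<bullet> b' = c b' * (x \<bullet> b')"
proof -
  have "(diag_in B c *v x) \<bullet> b' = (\<Sum>b\<in>B. c b * (x \<bullet> b) * (b \<bullet> b'))"
    by (simp add: diag_in_apply inner_sum_left)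
  also have "\<dots> = (\<Sum>b\<in>B. if b = b' then c b * (x \<bullet> b) else 0)"
    using orthonormal_inner[OF assms(1) _ assms(2)] by (intro sum.cong) auto
  finally show ?thesis using assms by (simp add: orthonormal_def)
qed

lemma diag_in_basis_vector:
  assumes "orthonormal B" "b \<in> B"
  shows "diag_in B c *v b = c b *\<^sub>R b"
proof -
  have "(\<Sum>b'\<in>B. (c b' * (b \<bullet> b')) *\<^sub>R b') = (\<Sum>b'\<in>B. if b' = b then c b *\<^sub>R b else 0)"
    using orthonormal_inner[OF assms(1) assms(2)] by (intro sum.cong) auto
  then show ?thesis using assms by (simp add: diag_in_apply orthonormal_def)
qed

lemma inner_diag_in: "(diag_in B c *v x) \<bullet> y = (\<Sum>b\<in>B. c b * ((x \<bullet> b) * (y \<bullet> b)))"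
  unfolding diag_in_apply inner_sum_left inner_scaleR_left
  by (simp only: inner_commute[of _ y] mult.assoc)

lemma diag_in_symmetric: "transpose (diag_in B c) = diag_in B c"
proof (rule symmetric_matrixI)
  fix x y
  show "(diag_in B c *v x) \<bullet> y = x \<bullet> (diag_in B c *v y)"
    unfolding inner_commute[of x "diag_in B c *v y"] inner_diag_in
    by (intro sum.cong refl) (simp add: mult.commute)
qed

lemma diag_in_psd: "(\<And>b. b \<in> B \<Longrightarrow> 0 \<le> c b) \<Longrightarrow> 0 \<le> v \<bullet> (diag_in B c *v v)"
  unfolding inner_commute[of v] inner_diag_in by (simp add: sum_nonneg)

lemma diag_in_mult:
  assumes "orthonormal B"
  shows "diag_in B c ** diag_in B d = diag_in B (\<lambda>b. c b * d b)"
proof -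
  have "diag_in B c *v (diag_in B d *v x) = diag_in B (\<lambda>b. c b * d b) *v x" for x
    unfolding diag_in_apply[of B c] diag_in_apply[of B "\<lambda>b. c b * d b"]
    by (rule sum.cong) (simp_all add: inner_diag_in_basis[OF assms] mult.assoc)
  then show ?thesis by (simp add: matrix_eq matrix_vector_mul_assoc)
qed

lemma orthonormal_eigenbasis_diag_in:
  assumes "orthonormal_eigenbasis G UNIV B"
  shows "diag_in B (\<lambda>b. b \<bullet> (G *v b)) = G"
proof (rule matrix_eq_on_orthonormal_basis)
  show "orthonormal B" "span B = UNIV" using assms by (simp_all add: orthonormal_eigenbasis_def)
  fix b assume "b \<in> B"
  then have "G *v b = (b \<bullet> (G *v b)) *\<^sub>R b" using assms by (simp add: orthonormal_eigenbasis_def)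
  then show "diag_in B (\<lambda>b. b \<bullet> (G *v b)) *v b = G *v b"
    using diag_in_basis_vector[OF \<open>orthonormal B\<close> \<open>b \<in> B\<close>] by simp
qed

section \<open>Square root, smallest singular value and pseudoinverse\<close>

lemma psd_sqrt_eigenvector:
  fixes R :: "real^'n^'n"
  assumes sym: "transpose R = R" and psd: "\<And>v. 0 \<le> v \<bullet> (R *v v)"
    and eig: "(R ** R) *v b = \<mu> *\<^sub>R b"
  shows "R *v b = sqrt \<mu> *\<^sub>R b"
proof -
  have Rb: "(R *v b) \<bullet> (R *v b) = \<mu> * (b \<bullet> b)"
    using eig inner_symmetric_matrix[OF sym, of b "R *v b"] by (simp add: matrix_vector_mul_assoc)
  consider "b = 0" | "\<mu> = 0" | "b \<noteq> 0" "\<mu> \<noteq> 0" by blast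
  then show ?thesis
  proof cases
    case 2
    then show ?thesis using Rb by simp
  next
    case 3
    then have "\<mu> > 0" using Rb by (smt (verit) inner_ge_zero inner_gt_zero_iff zero_le_mult_iff)
    define s where "s = sqrt \<mu>"
    have s: "s > 0" "s * s = \<mu>" using \<open>\<mu> > 0\<close> by (simp_all add: s_def)
    define u where "u = R *v b - s *\<^sub>R b"
    \<comment> \<open>u lies in the eigenspace of R for the eigenvalue -s, which positivity rules out.\<close>
    have "R *v u = - s *\<^sub>R u"
      using eig s
      by (simp add: u_def matrix_vector_mul_assoc vec.diff matrix_vector_mult_scaleR algebra_simps)
    then have "s * (u \<bullet> u) \<le> 0" using psd[of u] by simp
    then have "u \<bullet> u = 0" using s inner_ge_zero[of u] by (smt (verit) mult_pos_pos)
    then have "u = 0" by simp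
    then show ?thesis by (simp add: u_def s_def)
  qed simp
qed

lemma psd_sqrt_unique:
  fixes R R' :: "real^'n^'n"
  assumes "transpose R = R" "\<And>v. 0 \<le> v \<bullet> (R *v v)"
    and "transpose R' = R'" "\<And>v. 0 \<le> v \<bullet> (R' *v v)"
    and sq: "R ** R = R' ** R'"
  shows "R = R'"
proof -
  have "transpose (R ** R) = R ** R" using assms(1) by (simp add: matrix_transpose_mul)
  then obtain B where B: "orthonormal_eigenbasis (R ** R) UNIV B"
    using symmetric_matrix_orthonormal_eigenbasis by blast
  show ?thesis
  proof (rule matrix_eq_on_orthonormal_basis)
    show "orthonormal B" "span B = UNIV" using B by (simp_all add: orthonormal_eigenbasis_def)
    fix b assume "b \<in> B"
    then have "(R ** R) *v b = (b \<bullet> ((R ** R) *v b)) *\<^sub>R b"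
      using B by (simp add: orthonormal_eigenbasis_def)
    then show "R *v b = R' *v b"
      using psd_sqrt_eigenvector[of R] psd_sqrt_eigenvector[of R'] assms by metis
  qed
qed

lemma psd_sqrt_exists:
  fixes H :: "real^'n^'n"
  assumes sym: "transpose H = H" and psd: "\<And>v. 0 \<le> v \<bullet> (H *v v)"
  obtains R where "transpose R = R" "\<And>v. 0 \<le> v \<bullet> (R *v v)" "R ** R = H"
proof -
  obtain B where B: "orthonormal_eigenbasis H UNIV B"
    using symmetric_matrix_orthonormal_eigenbasis[OF sym] by blast
  then have ON: "orthonormal B" by (simp add: orthonormal_eigenbasis_def)
  define R where "R = diag_in B (\<lambda>b. sqrt (b \<bullet> (H *v b)))"
  have "R ** R = diag_in B (\<lambda>b. sqrt (b \<bullet> (H *v b)) * sqrt (b \<bullet> (H *v b)))"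
    by (simp add: R_def diag_in_mult[OF ON])
  also have "\<dots> = H"
    using psd orthonormal_eigenbasis_diag_in[OF B] by simp
  finally have "R ** R = H" .
  moreover have "transpose R = R" by (simp add: R_def diag_in_symmetric)
  moreover have "0 \<le> v \<bullet> (R *v v)" for v unfolding R_def by (rule diag_in_psd) (simp add: psd)
  ultimately show ?thesis using that by blast
qed

lemma msqrt:
  fixes H :: "real^'n^'n"
  assumes "transpose H = H" "\<And>v. 0 \<le> v \<bullet> (H *v v)"
  shows msqrt_symmetric: "transpose (msqrt H) = msqrt H" and msqrt_square: "msqrt H ** msqrt H = H"
proof -
  obtain R where R: "transpose R = R" "\<And>v. 0 \<le> v \<bullet> (R *v v)" "R ** R = H"
    using psd_sqrt_exists[OF assms] by blast
  have "msqrt H = R"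
    unfolding msqrt_def by (rule the_equality) (use R psd_sqrt_unique in auto)
  then show "transpose (msqrt H) = msqrt H" "msqrt H ** msqrt H = H" using R by simp_all
qed

lemma sigma_min_sq_le_eigenvalue:
  fixes C :: "real^'n^'m"
  assumes "v \<noteq> 0" "(transpose C ** C) *v v = \<mu> *\<^sub>R v" "\<mu> > 0"
  shows "(sigma_min C)^2 \<le> \<mu>"
proof -
  define \<Sigma> where "\<Sigma> = {\<sigma>. \<sigma> > 0 \<and> (\<exists>v. v \<noteq> 0 \<and> (transpose C ** C) *v v = (\<sigma>^2) *\<^sub>R v)}"
  have "(sqrt \<mu>)^2 = \<mu>" using assms(3) by simp
  then have "sqrt \<mu> \<in> \<Sigma>" using assms unfolding \<Sigma>_def by auto
  moreover have "bdd_below \<Sigma>" by (rule bdd_belowI[of _ 0]) (simp add: \<Sigma>_def)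
  ultimately have "Inf \<Sigma> \<le> sqrt \<mu>" by (rule cInf_lower)
  moreover have "0 \<le> Inf \<Sigma>"
    using \<open>sqrt \<mu> \<in> \<Sigma>\<close> by (intro cInf_greatest) (blast, simp add: \<Sigma>_def)
  ultimately have "(Inf \<Sigma>)^2 \<le> (sqrt \<mu>)^2" by (rule power_mono)
  with assms(3) show ?thesis by (simp add: sigma_min_def \<Sigma>_def)
qed

lemma sigma_min_sq_le:
  fixes C :: "real^'n^'m"
  assumes ker: "\<And>v. C *v v = 0 \<Longrightarrow> e \<bullet> v = 0"
  shows "(sigma_min C)^2 * (e \<bullet> e) \<le> (C *v e) \<bullet> (C *v e)"
proof -
  define G where "G = transpose C ** C"
  have "transpose G = G" by (simp add: G_def matrix_transpose_mul)
  then obtain B where B: "orthonormal_eigenbasis G UNIV B"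
    using symmetric_matrix_orthonormal_eigenbasis by blast
  then have ON: "orthonormal B" by (simp add: orthonormal_eigenbasis_def)
  define lam where "lam b = b \<bullet> (G *v b)" for b
  have lam: "lam b = (C *v b) \<bullet> (C *v b)" for b
    by (simp only: lam_def G_def matrix_vector_mul_assoc[symmetric] inner_transpose_right)
  have "(sigma_min C)^2 * ((e \<bullet> b) * (e \<bullet> b)) \<le> lam b * ((e \<bullet> b) * (e \<bullet> b))" if "b \<in> B" for b
  proof (cases "lam b = 0")
    case True
    then show ?thesis using ker[of b] by (simp add: lam)
  next
    case False
    then have "lam b > 0" by (simp add: lam order_less_le)
    moreover have "b \<noteq> 0" "G *v b = lam b *\<^sub>R b"
      using B that by (auto simp: orthonormal_eigenbasis_def orthonormal_def lam_def)
    ultimately show ?thesis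
      by (intro mult_right_mono sigma_min_sq_le_eigenvalue) (simp_all add: G_def)
  qed
  then have "(sigma_min C)^2 * (e \<bullet> e) \<le> (diag_in B lam *v e) \<bullet> e"
    using orthonormal_parseval[OF ON, of e e] B
    by (simp add: inner_diag_in orthonormal_eigenbasis_def sum_distrib_left sum_mono)
  also have "diag_in B lam = G"
    using orthonormal_eigenbasis_diag_in[OF B] by (simp add: lam_def[abs_def])
  also have "(G *v e) \<bullet> e = (C *v e) \<bullet> (C *v e)"
    by (simp only: G_def matrix_vector_mul_assoc[symmetric] inner_transpose_left)
  finally show ?thesis .
qed

definition penrose :: "real^'n^'m \<Rightarrow> real^'m^'n \<Rightarrow> bool" where
  "penrose A X \<longleftrightarrow> A ** X ** A = A \<and> X ** A ** X = X \<and>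
                   transpose (A ** X) = A ** X \<and> transpose (X ** A) = X ** A"

lemma penrose_unique:
  assumes "penrose A X" "penrose A Y"
  shows "X = Y"
proof -
  have X: "A ** X ** A = A" "X ** A ** X = X" "transpose (A ** X) = A ** X" "transpose (X ** A) = X ** A"
    and Y: "A ** Y ** A = A" "Y ** A ** Y = Y" "transpose (A ** Y) = A ** Y" "transpose (Y ** A) = Y ** A"
    using assms by (auto simp: penrose_def)
  have AX: "A ** X = transpose X ** transpose A" by (metis X(3) matrix_transpose_mul)
  have YA: "Y ** A = transpose A ** transpose Y" by (metis Y(4) matrix_transpose_mul)
  have AtAY: "transpose A ** (A ** Y) = transpose A" by (metis Y(1) Y(3) matrix_transpose_mul)
  have XAAt: "(X ** A) ** transpose A = transpose A"
    by (metis X(1) X(4) matrix_mul_assoc matrix_transpose_mul)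
  have "X = X ** (transpose X ** transpose A)" by (metis AX X(2) matrix_mul_assoc)
  also have "\<dots> = X ** (transpose X ** transpose A) ** (A ** Y)"
    by (metis AtAY matrix_mul_assoc)
  also have "\<dots> = X ** (A ** Y)" by (metis AX X(2) matrix_mul_assoc)
  also have "\<dots> = (X ** A) ** (transpose A ** transpose Y) ** Y"
    by (metis Y(2) YA matrix_mul_assoc)
  also have "\<dots> = Y" by (metis XAAt Y(2) YA matrix_mul_assoc)
  finally show ?thesis .
qed

lemma penrose_exists:
  fixes A :: "real^'n^'m"
  obtains X where "penrose A X"
proof -
  define G where "G = transpose A ** A"
  have "transpose G = G" by (simp add: G_def matrix_transpose_mul)
  then obtain B where B: "orthonormal_eigenbasis G UNIV B"
    using symmetric_matrix_orthonormal_eigenbasis by blast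
  then have ON: "orthonormal B" and span: "span B = UNIV"
    by (simp_all add: orthonormal_eigenbasis_def)
  define lam where "lam b = b \<bullet> (G *v b)" for b
  have G: "G = diag_in B lam" using orthonormal_eigenbasis_diag_in[OF B] by (simp add: lam_def[abs_def])
  \<comment> \<open>The candidate is (A^T A)^+ A^T, with the pseudoinverse of A^T A taken in its eigenbasis.\<close>
  define D where "D = diag_in B (\<lambda>b. inverse (lam b))"
  define X where "X = D ** transpose A"
  have XA: "X ** A = diag_in B (\<lambda>b. inverse (lam b) * lam b)"
    by (simp add: X_def D_def G_def[symmetric] G diag_in_mult[OF ON] matrix_mul_assoc[symmetric])
  have "A ** (X ** A) = A"
  proof (rule matrix_eq_on_orthonormal_basis[OF ON span])
    fix b assume "b \<in> B"
    have "lam b = (A *v b) \<bullet> (A *v b)"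
      by (simp only: lam_def G_def matrix_vector_mul_assoc[symmetric] inner_transpose_right)
    then show "(A ** (X ** A)) *v b = A *v b"
      using diag_in_basis_vector[OF ON \<open>b \<in> B\<close>]
      by (cases "lam b = 0")
        (simp_all add: XA matrix_vector_mul_assoc[symmetric] matrix_vector_mult_scaleR)
  qed
  moreover have "X ** A ** X = X"
  proof -
    have inv: "inverse t * t * inverse t = inverse t" for t :: real by (cases "t = 0") simp_all
    have "X ** A ** X = diag_in B (\<lambda>b. inverse (lam b) * lam b) ** (D ** transpose A)"
      unfolding XA by (simp only: X_def)
    also have "\<dots> = X"
      by (simp add: X_def D_def diag_in_mult[OF ON] matrix_mul_assoc inv)
    finally show ?thesis .
  qed
  moreover have "transpose (A ** X) = A ** X"
    by (simp add: X_def D_def matrix_transpose_mul diag_in_symmetric matrix_mul_assoc)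
  moreover have "transpose (X ** A) = X ** A"
    by (simp add: XA diag_in_symmetric)
  ultimately show ?thesis
    using that by (simp add: penrose_def matrix_mul_assoc)
qed

lemma pinv_penrose: "penrose A (pinv A)"
proof -
  obtain X where X: "penrose A X" using penrose_exists by blast
  have "pinv A = X"
    unfolding pinv_def by (rule the_equality) (use X penrose_unique in \<open>auto simp: penrose_def\<close>)
  with X show ?thesis by simp
qed

lemma pinv_solves:
  fixes A :: "real^'n^'m"
  assumes "A *v x = b"
  shows "A *v (pinv A *v b) = b"
  using pinv_penrose[of A] assms
  by (metis matrix_vector_mul_assoc penrose_def)

lemma pinv_in_range_transpose: "pinv A *v b \<in> range ((*v) (transpose A))"
proof -
  have "pinv A = pinv A ** A ** pinv A" using pinv_penrose[of A] by (simp add: penrose_def)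
  also have "\<dots> = transpose A ** (transpose (pinv A) ** pinv A)"
    using pinv_penrose[of A] by (metis matrix_mul_assoc matrix_transpose_mul penrose_def)
  finally show ?thesis by (metis matrix_vector_mul_assoc rangeI)
qed

section \<open>Orthogonal projection onto a span\<close>

lemma proj_span_unique:
  fixes U :: "'a::euclidean_space set"
  assumes "p \<in> span U" "\<And>u. u \<in> U \<Longrightarrow> (d - p) \<bullet> u = 0"
  shows "proj_span U d = p"
proof -
  have unique: "p' = p" if p': "p' \<in> span U" "\<forall>u\<in>U. (d - p') \<bullet> u = 0" for p'
  proof -
    have "orthogonal (p' - p) (p' - p)"
    proof (rule orthogonal_to_span)
      show "p' - p \<in> span U" using p'(1) assms(1) by (rule span_diff)
      show "orthogonal (p' - p) w" if "w \<in> U" for w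
        using assms(2)[OF that] p'(2) that by (simp add: orthogonal_def inner_diff_left)
    qed
    then show ?thesis by (metis orthogonal_self right_minus_eq)
  qed
  show ?thesis
    unfolding proj_span_def by (rule the_equality) (use assms unique in blast)+
qed

lemma proj_span:
  fixes U :: "'a::euclidean_space set"
  shows proj_span_in_span: "proj_span U d \<in> span U"
    and proj_span_orthogonal: "u \<in> span U \<Longrightarrow> (d - proj_span U d) \<bullet> u = 0"
proof -
  obtain y z where y: "y \<in> span U" and z: "\<And>w. w \<in> span U \<Longrightarrow> orthogonal z w" and d: "d = y + z"
    using orthogonal_subspace_decomp_exists[of U d] by blast
  have "proj_span U d = y"
  proof (rule proj_span_unique[OF y])
    show "(d - y) \<bullet> u = 0" if "u \<in> U" for u
      using z[OF span_base[OF that]] by (simp add: d orthogonal_def)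
  qed
  then show "proj_span U d \<in> span U" "u \<in> span U \<Longrightarrow> (d - proj_span U d) \<bullet> u = 0"
    using y z by (simp_all add: d orthogonal_def)
qed

lemma norm_diff_proj_span: "(norm (d - proj_span U d))^2 = (norm d)^2 - (norm (proj_span U d))^2"
proof -
  have "(d - proj_span U d) \<bullet> proj_span U d = 0" by (intro proj_span_orthogonal proj_span_in_span)
  then show ?thesis
    by (simp add: power2_norm_eq_inner inner_diff_left inner_diff_right inner_commute)
qed

lemma inner_le_norm_proj_span:
  assumes "u \<in> span U"
  shows "(d \<bullet> u)^2 \<le> (norm (proj_span U d))^2 * (norm u)^2"
proof -
  have "d \<bullet> u = proj_span U d \<bullet> u"
    using proj_span_orthogonal[OF assms, of d] by (simp add: inner_diff_left)
  then show ?thesis by (metis Cauchy_Schwarz_ineq power2_norm_eq_inner)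
qed

lemma proj_span_gain:
  fixes e d :: "'a::euclidean_space"
  assumes "V \<subseteq> U" "d \<in> U" "\<And>v. v \<in> V \<Longrightarrow> e \<bullet> v = 0"
  shows "(e \<bullet> d)^2 \<le> (norm (proj_span U e))^2 * (norm (d - proj_span V d))^2"
proof -
  have "e \<bullet> proj_span V d = 0"
    using orthogonal_to_span[OF proj_span_in_span, of V e d] assms(3)
    by (simp add: orthogonal_def inner_commute)
  moreover have "d - proj_span V d \<in> span U"
    using assms(1,2) span_mono[OF assms(1)] proj_span_in_span[of V d] by (auto intro: span_diff span_base)
  ultimately show ?thesis
    using inner_le_norm_proj_span[of "d - proj_span V d" U e] by (simp add: inner_diff_right)
qed

lemma span_set_list_combination:
  fixes cs :: "'a::real_vector list"
  shows "v \<in> span (set cs) \<Longrightarrow> \<exists>s. v = (\<Sum>j<length cs. s j *\<^sub>R cs ! j)"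
proof (induction cs arbitrary: v)
  case (Cons c cs)
  then obtain k where "v - k *\<^sub>R c \<in> span (set cs)" by (auto simp: span_insert)
  with Cons.IH obtain s where s: "v - k *\<^sub>R c = (\<Sum>j<length cs. s j *\<^sub>R cs ! j)" by blast
  have "(\<Sum>j<length (c # cs). (case j of 0 \<Rightarrow> k | Suc i \<Rightarrow> s i) *\<^sub>R (c # cs) ! j)
      = k *\<^sub>R c + (\<Sum>j<length cs. s j *\<^sub>R cs ! j)"
    by (simp only: length_Cons sum.lessThan_Suc_shift) simp
  also have "\<dots> = v" using s by (simp add: algebra_simps)
  finally show ?case by metis
qed simp

lemma proj_span_list_normal_equations:
  fixes cs :: "'a::euclidean_space list"
  shows "(\<forall>i<length cs. cs ! i \<bullet> (\<Sum>j<length cs. s j *\<^sub>R cs ! j) = cs ! i \<bullet> d)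
     \<longleftrightarrow> (\<Sum>j<length cs. s j *\<^sub>R cs ! j) = proj_span (set cs) d" (is "?normal \<longleftrightarrow> ?c = _")
proof
  assume ?normal
  have "(d - ?c) \<bullet> u = 0" if "u \<in> set cs" for u
  proof -
    from that obtain i where "i < length cs" "u = cs ! i" by (auto simp: in_set_conv_nth)
    with \<open>?normal\<close> have "u \<bullet> ?c = u \<bullet> d" by simp
    then show ?thesis by (simp add: inner_diff_left inner_diff_right inner_commute)
  qed
  moreover have "?c \<in> span (set cs)" by (intro span_sum span_scale span_base) simp
  ultimately show "?c = proj_span (set cs) d" by (intro proj_span_unique[symmetric]) auto
next
  assume proj: "?c = proj_span (set cs) d"
  show ?normal
  proof (intro allI impI)
    fix i assume "i < length cs"
    then have "(d - ?c) \<bullet> cs ! i = 0" unfolding proj by (intro proj_span_orthogonal span_base) simp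
    then show "cs ! i \<bullet> ?c = cs ! i \<bullet> d" by (simp add: inner_diff_left inner_diff_right inner_commute)
  qed
qed

section \<open>One step of RIM-AS\<close>

lemma subspace_range_transpose: "subspace (range ((*v) (transpose (A::real^'n^'m))))"
  by (intro linear_subspace_image) simp_all

lemma rim_d_in_range: "rim_d A b xs S \<in> range ((*v) (transpose (A::real^'n^'m)))"
  unfolding rim_d_def by (metis rangeI vec.neg)

lemma rim_d_inner:
  fixes A :: "real^'n^'m"
  assumes "A *v xstar = b"
  shows "rim_d A b xs S \<bullet> (xstar - last xs) = (norm (transpose S *v (A *v last xs - b)))^2"
proof -
  define r where "r = A *v last xs - b"
  define w where "w = S *v (transpose S *v r)"
  have "rim_d A b xs S \<bullet> (xstar - last xs) = (transpose A *v w) \<bullet> (last xs - xstar)"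
    by (simp add: rim_d_def w_def r_def inner_diff_right)
  also have "\<dots> = w \<bullet> r"
    using assms by (simp only: inner_transpose_left r_def matrix_vector_mult_diff_distrib)
  also have "\<dots> = (transpose S *v r) \<bullet> (transpose S *v r)"
    by (metis inner_transpose_left transpose_transpose w_def)
  finally show ?thesis by (simp add: r_def power2_norm_eq_inner)
qed

lemma rim_V_subset: "xs \<noteq> [] \<Longrightarrow> set (rim_V l xs) \<subseteq> (\<lambda>x. x - last xs) ` set xs"
  by (auto simp: rim_V_def Let_def last_conv_nth)

lemma rim_V_snoc:
  assumes "xs \<noteq> []"
  shows "set (rim_V l (xs @ [y])) \<subseteq> (\<lambda>u. u + (last xs - y)) ` insert 0 (set (rim_V l xs))"
proof
  fix v assume "v \<in> set (rim_V l (xs @ [y]))"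
  then obtain i where i: "Suc (length xs) - l \<le> i" "i < length xs" and v: "v = xs ! i - y"
    by (auto simp: rim_V_def Let_def nth_append)
  show "v \<in> (\<lambda>u. u + (last xs - y)) ` insert 0 (set (rim_V l xs))"
  proof (cases "i = length xs - 1")
    case True
    then have "v = 0 + (last xs - y)" using assms by (simp add: v last_conv_nth)
    then show ?thesis by blast
  next
    case False
    then have "xs ! i - last xs \<in> set (rim_V l xs)"
      using i assms by (auto simp: rim_V_def Let_def last_conv_nth intro!: image_eqI[where x=i])
    moreover have "v = (xs ! i - last xs) + (last xs - y)" by (simp add: v)
    ultimately show ?thesis by blast
  qed
qed

definition rim_invariant :: "real^'n^'m \<Rightarrow> nat \<Rightarrow> real^'n \<Rightarrow> (real^'n) list \<Rightarrow> bool" where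
  "rim_invariant A l xstar xs \<longleftrightarrow> xs \<noteq> [] \<and> set xs \<subseteq> range ((*v) (transpose A)) \<and>
     (\<forall>v\<in>set (rim_V l xs). v \<bullet> (last xs - xstar) = 0)"

lemma rim_step_eq_proj_span:
  fixes A :: "real^'n^'m"
  assumes sol: "A *v xstar = b" and orth: "\<forall>v\<in>set (rim_V l xs). v \<bullet> (last xs - xstar) = 0"
  shows "rim_step A b l xs S = last xs + proj_span (set (rim_V l xs @ [rim_d A b xs S])) (xstar - last xs)"
proof -
  define cols where "cols = rim_V l xs @ [rim_d A b xs S]"
  define \<gamma> where "\<gamma> = (norm (transpose S *v (A *v last xs - b)))^2"
  define p where "p = proj_span (set cols) (xstar - last xs)"
  define normal where "normal s \<longleftrightarrow> (\<forall>i<length cols.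
    cols ! i \<bullet> (\<Sum>j<length cols. s j *\<^sub>R cols ! j) = (if i = length cols - 1 then \<gamma> else 0))" for s
  \<comment> \<open>Under the invariant, the system M^T M s = gamma e defining the step consists of the
      normal equations of the projection of xstar - last xs onto span cols.\<close>
  have target: "cols ! i \<bullet> (xstar - last xs) = (if i = length cols - 1 then \<gamma> else 0)"
    if "i < length cols" for i
  proof (cases "i = length cols - 1")
    case True
    then show ?thesis using rim_d_inner[OF sol] by (simp add: cols_def \<gamma>_def nth_append)
  next
    case False
    then have "cols ! i \<in> set (rim_V l xs)" using that by (simp add: cols_def nth_append)
    then show ?thesis using orth False by (simp add: inner_diff_right)
  qed
  have normal_iff: "normal s \<longleftrightarrow> (\<Sum>j<length cols. s j *\<^sub>R cols ! j) = p" for s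
  proof -
    have "normal s \<longleftrightarrow> (\<forall>i<length cols.
        cols ! i \<bullet> (\<Sum>j<length cols. s j *\<^sub>R cols ! j) = cols ! i \<bullet> (xstar - last xs))"
      unfolding normal_def using target by auto
    also have "\<dots> \<longleftrightarrow> (\<Sum>j<length cols. s j *\<^sub>R cols ! j) = p"
      unfolding p_def by (rule proj_span_list_normal_equations)
    finally show ?thesis .
  qed
  have "p \<in> span (set cols)" unfolding p_def by (rule proj_span_in_span)
  then obtain s0 where "p = (\<Sum>j<length cols. s0 j *\<^sub>R cols ! j)"
    using span_set_list_combination by blast
  then have "normal (SOME s. normal s)" by (intro someI[of normal s0]) (simp add: normal_iff)
  then have "(\<Sum>j<length cols. (SOME s. normal s) j *\<^sub>R cols ! j) = p" by (simp add: normal_iff)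
  moreover have "rim_step A b l xs S = last xs + (\<Sum>j<length cols. (SOME s. normal s) j *\<^sub>R cols ! j)"
    unfolding rim_step_def Let_def normal_def cols_def \<gamma>_def by (rule refl)
  ultimately show ?thesis by (simp add: p_def cols_def)
qed

definition rim_ratio :: "real^'n^'m \<Rightarrow> real^'m \<Rightarrow> nat \<Rightarrow> (real^'n) list \<Rightarrow> real^'q^'m \<Rightarrow> real" where
  "rim_ratio A b l xs S = inverse (1 - (norm (proj_span (set (rim_V l xs)) (rim_d A b xs S)))^2
                                    / (norm (rim_d A b xs S))^2)"

lemma rim_step_error:
  fixes A :: "real^'n^'m"
  assumes sol: "A *v xstar = b" and orth: "\<forall>v\<in>set (rim_V l xs). v \<bullet> (last xs - xstar) = 0"
    and drawn: "transpose S *v (A *v last xs - b) \<noteq> 0"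
  defines "\<gamma> \<equiv> (norm (transpose S *v (A *v last xs - b)))^2"
  shows rim_d_nonzero: "rim_d A b xs S \<noteq> 0"
    and rim_ratio_ge_1: "1 \<le> rim_ratio A b l xs S"
    and rim_step_error_le: "(norm (rim_step A b l xs S - xstar))^2
           \<le> (norm (last xs - xstar))^2 - rim_ratio A b l xs S * \<gamma>^2 / (norm (rim_d A b xs S))^2"
proof -
  define d where "d = rim_d A b xs S"
  define V where "V = set (rim_V l xs)"
  define e where "e = xstar - last xs"
  define p where "p = proj_span (insert d V) e"
  define d' where "d' = d - proj_span V d"
  have "rim_step A b l xs S - xstar = - (e - p)"
    using rim_step_eq_proj_span[OF sol orth, of S] by (simp add: p_def d_def e_def V_def)
  then have error: "(norm (rim_step A b l xs S - xstar))^2 = (norm e)^2 - (norm p)^2"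
    using norm_diff_proj_span[of e "insert d V"] by (simp add: p_def norm_minus_commute)
  have perp: "e \<bullet> v = 0" if "v \<in> V" for v
    using orth that unfolding V_def e_def by (smt (verit) inner_commute inner_diff_right)
  have "e \<bullet> d = \<gamma>" using rim_d_inner[OF sol, of xs S] by (simp add: e_def d_def \<gamma>_def inner_commute)
  then have gain: "\<gamma>^2 \<le> (norm p)^2 * (norm d')^2"
    using proj_span_gain[of V "insert d V" d e, OF subset_insertI insertI1 perp]
    by (simp add: p_def d'_def)
  have "\<gamma> > 0" using drawn by (simp add: \<gamma>_def)
  with gain have "d' \<noteq> 0" by auto
  then have "(norm d')^2 > 0" by simp
  moreover have d': "(norm d')^2 = (norm d)^2 - (norm (proj_span V d))^2"
    unfolding d'_def by (rule norm_diff_proj_span)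
  ultimately have "(norm d)^2 > 0" using zero_le_power2[of "norm (proj_span V d)"] by linarith
  then show "rim_d A b xs S \<noteq> 0" by (simp add: d_def)
  have ratio: "rim_ratio A b l xs S = (norm d)^2 / (norm d')^2"
    using \<open>(norm d)^2 > 0\<close> d' by (simp add: rim_ratio_def d_def V_def field_simps)
  then show "1 \<le> rim_ratio A b l xs S"
    using \<open>(norm d')^2 > 0\<close> d' by simp
  have "rim_ratio A b l xs S * \<gamma>^2 / (norm d)^2 = \<gamma>^2 / (norm d')^2"
    using \<open>(norm d)^2 > 0\<close> by (simp add: ratio)
  also have "\<dots> \<le> (norm p)^2"
    using gain \<open>(norm d')^2 > 0\<close> by (simp add: divide_le_eq)
  finally show "(norm (rim_step A b l xs S - xstar))^2
      \<le> (norm (last xs - xstar))^2 - rim_ratio A b l xs S * \<gamma>^2 / (norm (rim_d A b xs S))^2"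
    using error by (simp add: e_def d_def norm_minus_commute)
qed

lemma rim_invariant_snoc:
  fixes A :: "real^'n^'m"
  assumes sol: "A *v xstar = b" and inv: "rim_invariant A l xstar xs"
  shows "rim_invariant A l xstar (xs @ [rim_step A b l xs S])"
proof -
  let ?R = "range ((*v) (transpose A))"
  define cols where "cols = set (rim_V l xs @ [rim_d A b xs S])"
  define p where "p = proj_span cols (xstar - last xs)"
  have ne: "xs \<noteq> []" and xsR: "set xs \<subseteq> ?R"
    and orth: "\<forall>v\<in>set (rim_V l xs). v \<bullet> (last xs - xstar) = 0"
    using inv by (simp_all add: rim_invariant_def)
  have step: "rim_step A b l xs S = last xs + p"
    using rim_step_eq_proj_span[OF sol orth] by (simp add: p_def cols_def)
  have "last xs \<in> ?R" using xsR ne by auto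
  have "x - last xs \<in> ?R" if "x \<in> set xs" for x
    using xsR that \<open>last xs \<in> ?R\<close> by (intro subspace_diff[OF subspace_range_transpose]) auto
  then have "set (rim_V l xs) \<subseteq> ?R" using rim_V_subset[OF ne, of l] by blast
  then have "cols \<subseteq> ?R" using rim_d_in_range[of A b xs S] by (simp add: cols_def del: transpose_matrix_vector)
  then have "span cols \<subseteq> ?R" by (intro span_minimal subspace_range_transpose)
  then have "p \<in> ?R" using proj_span_in_span p_def by blast
  then have "rim_step A b l xs S \<in> ?R"
    unfolding step by (rule subspace_add[OF subspace_range_transpose \<open>last xs \<in> ?R\<close>])
  moreover have "v \<bullet> (rim_step A b l xs S - xstar) = 0"
    if v_new: "v \<in> set (rim_V l (xs @ [rim_step A b l xs S]))" for v
  proof -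
    \<comment> \<open>The new stored directions lie in the search space, to which the new error is orthogonal.\<close>
    obtain u where u: "u \<in> insert 0 (set (rim_V l xs))" and v: "v = u - p"
      using rim_V_snoc[OF ne] v_new step by fastforce
    have "u \<in> span cols" using u by (auto simp: cols_def span_base span_0)
    then have "v \<in> span cols" unfolding v p_def by (rule span_diff[OF _ proj_span_in_span])
    then have "((xstar - last xs) - p) \<bullet> v = 0" unfolding p_def by (rule proj_span_orthogonal)
    then show ?thesis by (simp add: step inner_commute inner_diff_left inner_diff_right algebra_simps)
  qed
  ultimately show ?thesis using inv by (auto simp: rim_invariant_def)
qed

lemma rim_hist_invariant:
  fixes A :: "real^'n^'m"
  assumes "A *v xstar = b" "x0 \<in> range ((*v) (transpose A))"
  shows "rim_invariant A l xstar (rim_hist A b l x0 Ss k)"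
proof (induction k)
  case 0
  then show ?case using assms(2) by (simp add: rim_invariant_def rim_V_def)
next
  case (Suc k)
  then show ?case using rim_invariant_snoc[OF assms(1)] by (simp add: Let_def)
qed

section \<open>The weight matrix H\<close>

lemma inner_matrix_integral:
  fixes F :: "'a \<Rightarrow> real^'m^'m"
  assumes "integrable M F"
  shows "integrable M (\<lambda>S. (F S *v x) \<bullet> y)" and "(integral\<^sup>L M F *v x) \<bullet> y = (\<integral>S. (F S *v x) \<bullet> y \<partial>M)"
proof -
  have "linear (\<lambda>X::real^'m^'m. (X *v x) \<bullet> y)"
    by (simp add: linear_iff matrix_vector_mult_add_rdistrib inner_add_left
        scaleR_matrix_vector_assoc[symmetric])
  then have "bounded_linear (\<lambda>X::real^'m^'m. (X *v x) \<bullet> y)"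
    by (simp add: linear_conv_bounded_linear)
  from integrable_bounded_linear[OF this assms] integral_bounded_linear[OF this assms]
  show "integrable M (\<lambda>S. (F S *v x) \<bullet> y)" "(integral\<^sup>L M F *v x) \<bullet> y = (\<integral>S. (F S *v x) \<bullet> y \<partial>M)"
    by simp_all
qed

lemma inner_mult_transpose_self:
  fixes S :: "real^'q^'m"
  shows "((S ** transpose S) *v x) \<bullet> y = (transpose S *v x) \<bullet> (transpose S *v y)"
  by (metis inner_transpose_left matrix_vector_mul_assoc transpose_transpose)

lemma ae_transpose_zero_imp_zero:
  fixes M :: "(real^'q^'m) measure"
  assumes "integrable M (\<lambda>S. S ** transpose S)" "pos_def_mat (integral\<^sup>L M (\<lambda>S. S ** transpose S))"
    and "AE S in M. transpose S *v v = 0"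
  shows "v = 0"
proof (rule ccontr)
  assume "v \<noteq> 0"
  then have "0 < (integral\<^sup>L M (\<lambda>S. S ** transpose S) *v v) \<bullet> v"
    using assms(2) by (simp add: pos_def_mat_def inner_commute)
  also have "\<dots> = (\<integral>S. (transpose S *v v) \<bullet> (transpose S *v v) \<partial>M)"
    using inner_matrix_integral(2)[OF assms(1)] by (simp add: inner_mult_transpose_self)
  also have "\<dots> = 0"
    using assms(3) by (simp add: integral_eq_zero_AE)
  finally show False by simp
qed

context
  fixes M :: "(real^'q^'m) measure" and A :: "real^'n^'m"
  assumes H: "integrable M (\<lambda>S. (1 / (spec_norm (transpose S ** A))^2) *\<^sub>R (S ** transpose S))"
begin

lemma Hmat_inner:
  shows "integrable M (\<lambda>S. (transpose S *v x) \<bullet> (transpose S *v y) / (spec_norm (transpose S ** A))^2)"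
    and "(Hmat M A *v x) \<bullet> y
           = (\<integral>S. (transpose S *v x) \<bullet> (transpose S *v y) / (spec_norm (transpose S ** A))^2 \<partial>M)"
  using inner_matrix_integral[OF H, of x y]
  by (simp_all add: Hmat_def inner_mult_transpose_self scaleR_matrix_vector_assoc[symmetric]
      del: transpose_matrix_vector)

lemma Hmat_symmetric: "transpose (Hmat M A) = Hmat M A"
proof (rule symmetric_matrixI)
  fix x y
  have "(Hmat M A *v x) \<bullet> y = (Hmat M A *v y) \<bullet> x"
    unfolding Hmat_inner(2) by (simp add: inner_commute)
  then show "(Hmat M A *v x) \<bullet> y = x \<bullet> (Hmat M A *v y)" by (simp add: inner_commute)
qed

lemma Hmat_psd: "0 \<le> v \<bullet> (Hmat M A *v v)"
  by (simp add: inner_commute[of v] Hmat_inner(2) integral_nonneg_AE)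

context
  assumes SS: "integrable M (\<lambda>S. S ** transpose S)" "pos_def_mat (integral\<^sup>L M (\<lambda>S. S ** transpose S))"
begin

lemma Hmat_definite_on_range:
  assumes zero: "(A *v u) \<bullet> (Hmat M A *v (A *v u)) = 0"
  shows "A *v u = 0"
proof (rule ae_transpose_zero_imp_zero[OF SS])
  let ?v = "A *v u"
  have "(\<integral>S. (transpose S *v ?v) \<bullet> (transpose S *v ?v) / (spec_norm (transpose S ** A))^2 \<partial>M) = 0"
    using zero Hmat_inner(2)[of ?v ?v] by (simp add: inner_commute)
  then have "AE S in M. (transpose S *v ?v) \<bullet> (transpose S *v ?v) / (spec_norm (transpose S ** A))^2 = 0"
    by (subst (asm) integral_nonneg_eq_0_iff_AE[OF Hmat_inner(1)]) simp_all
  then show "AE S in M. transpose S *v ?v = 0"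
  proof eventually_elim
    case (elim S)
    \<comment> \<open>A draw with spec_norm (S^T A) = 0 carries weight 1/0 = 0, but then S^T A = 0 anyway.\<close>
    show ?case
    proof (cases "spec_norm (transpose S ** A) = 0")
      case True
      then have "(transpose S ** A) *v u = 0"
        unfolding spec_norm_def by (subst (asm) onorm_eq_0) (simp_all add: matrix_vector_mul_bounded_linear)
      then show ?thesis by (simp add: matrix_vector_mul_assoc del: transpose_matrix_vector)
    next
      case False
      then show ?thesis using elim by simp
    qed
  qed
qed

lemma sigma_min_Hmat_le:
  assumes e: "e \<in> range ((*v) (transpose A))"
  shows "(sigma_min (msqrt (Hmat M A) ** A))^2 * (e \<bullet> e) \<le> (A *v e) \<bullet> (Hmat M A *v (A *v e))"
proof -
  define R where "R = msqrt (Hmat M A)"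
  have R: "transpose R = R" "R ** R = Hmat M A"
    unfolding R_def using msqrt[OF Hmat_symmetric Hmat_psd] by simp_all
  have RA: "((R ** A) *v v) \<bullet> ((R ** A) *v v) = (A *v v) \<bullet> (Hmat M A *v (A *v v))" for v
    using inner_symmetric_matrix[OF R(1), of "A *v v" "R *v (A *v v)"]
    by (simp add: matrix_vector_mul_assoc matrix_mul_assoc R(2) del: transpose_matrix_vector)
  have "e \<bullet> v = 0" if "(R ** A) *v v = 0" for v
  proof -
    have "A *v v = 0" using RA[of v] that by (intro Hmat_definite_on_range) simp
    moreover obtain y where "e = transpose A *v y" using e by blast
    ultimately show ?thesis by (simp add: inner_transpose_left del: transpose_matrix_vector)
  qed
  then show ?thesis using sigma_min_sq_le[of "R ** A" e] RA by (simp add: R_def)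
qed

end

end

section \<open>Expected decrease of the error\<close>

lemma set_integral_div_measure_le:
  fixes f g :: "'a \<Rightarrow> real"
  assumes M: "prob_space M" and Q: "Q \<in> sets M" and g: "integrable M g"
    and g_nonneg: "\<And>x. x \<in> space M \<Longrightarrow> 0 \<le> g x" and g_zero: "\<And>x. x \<in> space M - Q \<Longrightarrow> g x = 0"
    and "0 \<le> c" and f_nonneg: "\<And>x. x \<in> Q \<Longrightarrow> 0 \<le> f x" and f_le: "\<And>x. x \<in> Q \<Longrightarrow> f x \<le> c - g x"
  shows "(LINT x:Q|M. f x) / measure M Q \<le> c - integral\<^sup>L M g"
proof -
  interpret prob_space M by (rule M)
  have "g x \<le> c" if "x \<in> space M" for x
    using that f_nonneg[of x] f_le[of x] g_zero[of x] \<open>0 \<le> c\<close> by (cases "x \<in> Q") auto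
  then have g_le: "integral\<^sup>L M g \<le> c"
    using integral_mono[of M g "\<lambda>_. c"] g by (simp add: prob_space)
  show ?thesis
  proof (cases "set_integrable M Q f \<and> measure M Q > 0")
    case False
    \<comment> \<open>Then the left-hand side is 0: a non-integrable f has integral 0, and x / 0 = 0.\<close>
    then have "(LINT x:Q|M. f x) = 0 \<or> measure M Q = 0"
      by (auto simp: set_lebesgue_integral_def set_integrable_def not_integrable_integral_eq
          order_less_le measure_nonneg)
    with g_le show ?thesis by auto
  next
    case True
    then have f: "set_integrable M Q f" and pos: "measure M Q > 0" by auto
    have c: "set_integrable M Q (\<lambda>x. c)"
      unfolding set_integrable_def by (rule integrable_mult_indicator[OF Q integrable_const])
    have g': "set_integrable M Q g"
      unfolding set_integrable_def by (rule integrable_mult_indicator[OF Q g])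
    have "integral\<^sup>L M g = (LINT x:Q|M. g x)"
      unfolding set_lebesgue_integral_def using g_zero Q sets.sets_into_space
      by (intro Bochner_Integration.integral_cong) (auto simp: indicator_def)
    moreover have "(LINT x:Q|M. f x) \<le> (LINT x:Q|M. c - g x)"
      using f c g' f_le by (intro set_integral_mono) auto
    ultimately have "(LINT x:Q|M. f x) \<le> c * measure M Q - integral\<^sup>L M g"
      using c g' Q by (simp add: set_integral_const mult.commute)
    then have "(LINT x:Q|M. f x) / measure M Q \<le> c - integral\<^sup>L M g / measure M Q"
      using pos by (simp add: field_simps)
    also have "\<dots> \<le> c - integral\<^sup>L M g"
      using pos prob_le_1[of Q] integral_nonneg_AE[of g] g_nonneg
      by (simp add: le_divide_eq mult_left_le)
    finally show ?thesis .
  qed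
qed

lemma rim_Q_sets:
  fixes M :: "(real^'q^'m) measure"
  assumes "(\<lambda>S. S) \<in> borel_measurable M"
  shows "rim_Q M A b x \<in> sets M"
proof -
  have "(\<lambda>S::real^'q^'m. transpose S *v r) \<in> borel_measurable borel" for r :: "real^'m"
    by (intro borel_measurable_continuous_onI linear_continuous_on linear_conv_bounded_linear[THEN iffD1])
      (simp add: linear_iff vec_eq_iff vector_matrix_mult_def sum.distrib sum_distrib_left algebra_simps)
  with assms have [measurable]: "(\<lambda>S. transpose S *v r) \<in> borel_measurable M" for r
    using measurable_compose by blast
  show ?thesis unfolding rim_Q_def by measurable
qed

lemma rim_d_norm_le:
  fixes A :: "real^'n^'m"
  shows "norm (rim_d A b xs S) \<le> spec_norm (transpose S ** A) * norm (transpose S *v (A *v last xs - b))"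
proof -
  have "rim_d A b xs S = - (transpose (transpose S ** A) *v (transpose S *v (A *v last xs - b)))"
    by (simp add: rim_d_def matrix_transpose_mul matrix_vector_mul_assoc matrix_mul_assoc
        del: transpose_matrix_vector)
  then show ?thesis
    using norm_transpose_le_onorm[of "transpose S ** A"] by (simp add: spec_norm_def)
qed

lemma rim_step_error_weighted:
  fixes A :: "real^'n^'m"
  assumes sol: "A *v xstar = b" and orth: "\<forall>v\<in>set (rim_V l xs). v \<bullet> (last xs - xstar) = 0"
    and drawn: "transpose S *v (A *v last xs - b) \<noteq> 0"
    and q: "0 \<le> q" "q \<le> rim_ratio A b l xs S"
  shows "(norm (rim_step A b l xs S - xstar))^2 \<le> (norm (last xs - xstar))^2
           - q * ((norm (transpose S *v (A *v last xs - b)))^2 / (spec_norm (transpose S ** A))^2)"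
proof -
  define \<gamma> where "\<gamma> = (norm (transpose S *v (A *v last xs - b)))^2"
  define N where "N = spec_norm (transpose S ** A)"
  define D where "D = (norm (rim_d A b xs S))^2"
  have "D > 0" using rim_d_nonzero[OF sol orth drawn] by (simp add: D_def)
  have "D \<le> N^2 * \<gamma>"
    using power_mono[OF rim_d_norm_le norm_ge_zero]
    by (simp add: D_def N_def \<gamma>_def power_mult_distrib)
  have "\<gamma> / N^2 \<le> \<gamma>^2 / D"
  proof (cases "N = 0")
    case False
    then have "\<gamma> * D \<le> \<gamma>^2 * N^2"
      using mult_left_mono[OF \<open>D \<le> N^2 * \<gamma>\<close>, of \<gamma>] by (simp add: \<gamma>_def power2_eq_square ac_simps)
    with False \<open>D > 0\<close> show ?thesis by (simp add: field_simps)
  qed (use \<open>D > 0\<close> in simp)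
  then have "q * (\<gamma> / N^2) \<le> q * (\<gamma>^2 / D)" using q(1) by (rule mult_left_mono)
  also have "\<dots> \<le> rim_ratio A b l xs S * (\<gamma>^2 / D)"
    using q(2) \<open>D > 0\<close> by (intro mult_right_mono) simp_all
  finally show ?thesis using rim_step_error_le[OF sol orth drawn] by (simp add: \<gamma>_def N_def D_def)
qed

lemma rim_q_bounds:
  fixes A :: "real^'n^'m"
  assumes sol: "A *v xstar = b" and orth: "\<forall>v\<in>set (rim_V l xs). v \<bullet> (last xs - xstar) = 0"
    and ne: "rim_Q M A b (last xs) \<noteq> {}"
  shows "1 \<le> rim_q M A b l xs"
    and "S \<in> rim_Q M A b (last xs) \<Longrightarrow> rim_q M A b l xs \<le> rim_ratio A b l xs S"
proof -
  have q: "rim_q M A b l xs = Inf (rim_ratio A b l xs ` rim_Q M A b (last xs))"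
    by (simp add: rim_q_def rim_ratio_def)
  have ratio_ge: "1 \<le> rim_ratio A b l xs S" if "S \<in> rim_Q M A b (last xs)" for S
    using that by (intro rim_ratio_ge_1[OF sol orth]) (simp add: rim_Q_def)
  show "1 \<le> rim_q M A b l xs" unfolding q using ne ratio_ge by (intro cInf_greatest) auto
  show "rim_q M A b l xs \<le> rim_ratio A b l xs S" if "S \<in> rim_Q M A b (last xs)"
    unfolding q using that ratio_ge by (intro cInf_lower bdd_belowI[of _ 1]) auto
qed

lemma rim_Q_empty_imp_solved:
  fixes M :: "(real^'q^'m) measure" and A :: "real^'n^'m"
  assumes SS: "integrable M (\<lambda>S. S ** transpose S)" "pos_def_mat (integral\<^sup>L M (\<lambda>S. S ** transpose S))"
    and sol: "A *v xstar = b" and e: "x - xstar \<in> range ((*v) (transpose A))"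
    and empty: "rim_Q M A b x = {}"
  shows "x = xstar"
proof -
  have "AE S in M. transpose S *v (A *v (x - xstar)) = 0"
    using empty sol by (intro AE_I2) (auto simp: rim_Q_def matrix_vector_mult_diff_distrib)
  then have "A *v (x - xstar) = 0" by (rule ae_transpose_zero_imp_zero[OF SS])
  moreover obtain y where "x - xstar = transpose A *v y" using e by blast
  ultimately have "(x - xstar) \<bullet> (x - xstar) = 0" by (metis inner_transpose_left inner_zero_right)
  then show ?thesis by simp
qed

lemma rim_expected_error_le:
  fixes M :: "(real^'q^'m) measure" and A :: "real^'n^'m"
  assumes prob: "prob_space M" and meas: "(\<lambda>S. S) \<in> borel_measurable M"
    and SS: "integrable M (\<lambda>S. S ** transpose S)" "pos_def_mat (integral\<^sup>L M (\<lambda>S. S ** transpose S))"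
    and H: "integrable M (\<lambda>S. (1 / (spec_norm (transpose S ** A))^2) *\<^sub>R (S ** transpose S))"
    and sol: "A *v xstar = b" and xstar: "xstar \<in> range ((*v) (transpose A))"
    and inv: "rim_invariant A l xstar xs"
  defines "Q \<equiv> rim_Q M A b (last xs)"
  shows "(LINT S:Q|M. (norm (rim_step A b l xs S - xstar))^2) / measure M Q
           \<le> (1 - rim_q M A b l xs * (sigma_min (msqrt (Hmat M A) ** A))^2) * (norm (last xs - xstar))^2"
proof -
  define e where "e = last xs - xstar"
  define r where "r = A *v last xs - b"
  define q where "q = rim_q M A b l xs"
  define w where "w = (\<lambda>S::real^'q^'m. (norm (transpose S *v r))^2 / (spec_norm (transpose S ** A))^2)"
  define g where "g = (\<lambda>S. q * w S)"
  have orth: "\<forall>v\<in>set (rim_V l xs). v \<bullet> (last xs - xstar) = 0" using inv by (simp add: rim_invariant_def)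
  have "last xs \<in> range ((*v) (transpose A))" using inv by (auto simp: rim_invariant_def)
  then have e: "e \<in> range ((*v) (transpose A))"
    unfolding e_def using xstar by (rule subspace_diff[OF subspace_range_transpose])
  show ?thesis
  proof (cases "Q = {}")
    case True
    \<comment> \<open>Then rim_q is the unspecified Inf {}, but the error already vanishes.\<close>
    then show ?thesis using rim_Q_empty_imp_solved[OF SS sol e[unfolded e_def]] by (simp add: Q_def)
  next
    case False
    have q: "1 \<le> q" "\<And>S. S \<in> Q \<Longrightarrow> q \<le> rim_ratio A b l xs S"
      using rim_q_bounds[OF sol orth False[unfolded Q_def]] by (simp_all add: q_def Q_def)
    have "integrable M w" "integral\<^sup>L M w = r \<bullet> (Hmat M A *v r)"
      using Hmat_inner[OF H, of r r] by (simp_all add: w_def power2_norm_eq_inner inner_commute)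
    then have g: "integrable M g" "integral\<^sup>L M g = q * (r \<bullet> (Hmat M A *v r))"
      by (simp_all add: g_def)
    have "(LINT S:Q|M. (norm (rim_step A b l xs S - xstar))^2) / measure M Q \<le> (norm e)^2 - integral\<^sup>L M g"
    proof (rule set_integral_div_measure_le[OF prob _ g(1)])
      show "Q \<in> sets M" unfolding Q_def by (rule rim_Q_sets[OF meas])
      show "0 \<le> g S" for S using q(1) by (simp add: g_def w_def)
      show "g S = 0" if "S \<in> space M - Q" for S using that by (simp add: Q_def rim_Q_def g_def w_def r_def)
      show "(norm (rim_step A b l xs S - xstar))^2 \<le> (norm e)^2 - g S" if "S \<in> Q" for S
        using that q rim_step_error_weighted[OF sol orth, of S q]
        by (simp add: Q_def rim_Q_def g_def w_def r_def e_def)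
    qed simp_all
    also have "\<dots> \<le> (1 - q * (sigma_min (msqrt (Hmat M A) ** A))^2) * (norm e)^2"
      using mult_left_mono[OF sigma_min_Hmat_le[OF H SS e], of q] q(1)
      by (simp add: g sol e_def r_def matrix_vector_mult_diff_distrib power2_norm_eq_inner algebra_simps)
    finally show ?thesis by (simp add: q_def e_def)
  qed
qed

theorem theorem3p2:
  fixes A :: "real^'n^'m" and b :: "real^'m" and M :: "(real^'q^'m) measure"
    and l :: nat and x0 :: "real^'n" and Ss :: "nat \<Rightarrow> real^'q^'m" and k :: nat
  assumes "prob_space M"
    and "(\<lambda>S. S) \<in> borel_measurable M"
    and "\<exists>x. A *v x = b"
    and "integrable M (\<lambda>S. S ** transpose S)"
    and "pos_def_mat (integral\<^sup>L M (\<lambda>S. S ** transpose S))"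
    and "integrable M (\<lambda>S. scaleR (1 / (spec_norm (transpose S ** A))^2) (S ** transpose S))"
    and "l > 0"
    and "\<exists>y. x0 = transpose A *v y"
    and "\<forall>i<k. Ss i \<in> space M \<and>
           transpose (Ss i) *v (A *v last (rim_hist A b l x0 Ss i) - b) \<noteq> 0"
  shows "(let xs = rim_hist A b l x0 Ss k; xk = last xs; Q = rim_Q M A b xk; xstar = pinv A *v b
          in (LINT S:Q|M. (norm (rim_step A b l xs S - xstar))^2) / measure M Q
             \<le> (1 - rim_q M A b l xs * (sigma_min (msqrt (Hmat M A) ** A))^2) * (norm (xk - xstar))^2)"
proof -
  \<comment> \<open>The invariant holds whatever S_0, ..., S_(k-1) were.\<close>
  obtain x where "A *v x = b" using assms(3) by blast
  define xstar where "xstar = pinv A *v b"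
  have sol: "A *v xstar = b" unfolding xstar_def by (rule pinv_solves[OF \<open>A *v x = b\<close>])
  have "xstar \<in> range ((*v) (transpose A))" unfolding xstar_def by (rule pinv_in_range_transpose)
  moreover have "rim_invariant A l xstar (rim_hist A b l x0 Ss k)"
    using assms(8) by (intro rim_hist_invariant[OF sol]) blast
  ultimately show ?thesis
    using rim_expected_error_le[OF assms(1,2,4,5,6) sol] by (simp add: Let_def xstar_def)
qed

end
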